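(* Let $G=(V,E)$ be a graph and let $I\subseteq V$ be such that $\alpha(G_I)=2$. Let $X_I=(X_{ij})_{i,j\in I}$ be a real symmetric matrix with rows and columns indexed by $I$. Then $X_I\in \mathrm{STAB}^2(G_I)$ if and only if all of the following constraints are satisfied: \begin{align*} X_{ii} &\ge 0 && \forall i\in I,\\ X_{ij} &= 0 && \forall \{i,j\}\in E(G_I),\\ X_{ij} &\ge 0 && \forall \{i,j\}\in \overline{E}(G_I),\\ \sum_{j\in I:\ \{i,j\}\in\overline{E}(G_I)} X_{ij} &\le X_{ii} && \forall i\in I,\\ \sum_{i\in I} X_{ii} &\le 1+\sum_{\{i,j\}\in\overline{E}(G_I)} X_{ij}. \end{align*} In the last inequality the sum on the right runs over unordered pairs.
   Context: Graphs are finite, simple and undirected. For $I\subseteq V$, $G_I$ is the subgraph of $G$ induced by $I$; $E(G_I)$ is its edge set and $\overline{E}(G_I)$ is the set of unordered pairs $\{i,j\}$ of distinct vertices of $I$ that are not edges of $G_I$. $\alpha(H)$ is the stability number of $H$ (maximum cardinality of a set of pairwise non-adjacent vertices). For a graph $H$, $\mathcal{S}(H)\subseteq\{0,1\}^{V(H)}$ is the set of incidence vectors of stable sets of $H$ (including the empty set), $\mathcal{S}^2(H)=\{ss^\top : s\in\mathcal{S}(H)\}$, and $\mathrm{STAB}^2(H)=\mathrm{conv}\,\mathcal{S}^2(H)$. *)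

theory Defs
  imports "HOL-Analysis.Analysis"
begin

type_synonym 'v ugraph = "'v set \<times> 'v set set"

abbreviation verts :: "'v ugraph \<Rightarrow> 'v set" where "verts G \<equiv> fst G"
abbreviation edges :: "'v ugraph \<Rightarrow> 'v set set" where "edges G \<equiv> snd G"

definition simple_graph :: "'v ugraph \<Rightarrow> bool" where
  "simple_graph G \<longleftrightarrow> finite (verts G) \<and> (\<forall>e\<in>edges G. e \<subseteq> verts G \<and> card e = 2)"

definition induced :: "'v ugraph \<Rightarrow> 'v set \<Rightarrow> 'v ugraph" where
  "induced G I = (I, {e \<in> edges G. e \<subseteq> I})"

definition nonedges :: "'v ugraph \<Rightarrow> 'v set set" where
  "nonedges G = {e. e \<subseteq> verts G \<and> card e = 2 \<and> e \<notin> edges G}"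

definition stable_sets :: "'v ugraph \<Rightarrow> 'v set set" where
  "stable_sets G = {S. S \<subseteq> verts G \<and> (\<forall>u\<in>S. \<forall>v\<in>S. u \<noteq> v \<longrightarrow> {u, v} \<notin> edges G)}"

definition stability_number :: "'v ugraph \<Rightarrow> nat" where
  "stability_number G = Max (card ` stable_sets G)"

text \<open>
  Vertices are drawn from a finite type. Vectors and matrices indexed by a vertex set \<open>I\<close>
  are represented by vectors and matrices over the whole type that vanish outside \<open>I\<close> and
  \<open>I \<times> I\<close>; these form a linear subspace isomorphic to the space of vectors or matrices
  indexed by \<open>I\<close>, so convex hulls agree.
\<close>

definition stable_vectors :: "'v::finite ugraph \<Rightarrow> (real ^ 'v) set" where
  "stable_vectors H = (\<lambda>S. \<chi> v. indicator S v) ` stable_sets H"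

definition outer :: "real ^ 'v \<Rightarrow> real ^ 'v ^ 'v" where
  "outer s = (\<chi> i j. s $ i * s $ j)"

definition stable_matrices :: "'v::finite ugraph \<Rightarrow> (real ^ 'v ^ 'v) set" where
  "stable_matrices H = outer ` stable_vectors H"

definition STAB2 :: "'v::finite ugraph \<Rightarrow> (real ^ 'v ^ 'v) set" where
  "STAB2 H = convex hull (stable_matrices H)"

definition submatrix_on :: "'v set \<Rightarrow> real ^ 'v ^ 'v \<Rightarrow> real ^ 'v ^ 'v" where
  "submatrix_on I X = (\<chi> i j. if i \<in> I \<and> j \<in> I then X $ i $ j else 0)"

text \<open>
  The entry of \<open>X\<close> at an unordered pair. It is well defined when \<open>X\<close> is symmetric
  on that pair, as \<open>pair_entry_eq\<close> shows, and is used only then.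
\<close>

definition pair_entry :: "real ^ 'v ^ 'v \<Rightarrow> 'v set \<Rightarrow> real" where
  "pair_entry X e = (THE x. \<exists>i j. e = {i, j} \<and> x = X $ i $ j)"

lemma pair_entry_eq:
  assumes "i \<noteq> j" "X $ i $ j = X $ j $ i"
  shows "pair_entry X {i, j} = X $ i $ j"
  unfolding pair_entry_def
  by (rule the_equality) (use assms in \<open>auto simp: doubleton_eq_iff\<close>)

end

theory Submission
  imports Defs
begin

text \<open>
  Let \<open>H\<close> be the induced subgraph. As \<open>\<alpha>(H) = 2\<close>, its stable sets are the empty set, the
  singletons and the non-edges (\<open>stable_sets_eq_if_stability_number_2\<close>).
  A convex combination of the matrices \<open>s s\<^sup>T\<close> with weights \<open>u S\<close> has as its entry at \<open>(i, j)\<close> the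
  total weight of the stable sets that contain both \<open>i\<close> and \<open>j\<close> (\<open>mem_STAB2_iff_weights\<close>). So the
  entry at a non-edge \<open>e\<close> is \<open>u e\<close>, the entry at an edge is \<open>0\<close>, and the \<open>i\<close>-th diagonal entry is
  \<open>u {i}\<close> plus the weights of the non-edges through \<open>i\<close>. With the condition that the weights sum
  to \<open>1\<close>, this is a triangular system for \<open>u\<close>. Its solution is \<open>u {i, j} = X\<^sub>i\<^sub>j\<close> at the non-edges,
  \<open>u {i} = X\<^sub>i\<^sub>i - \<Sum> X\<^sub>i\<^sub>j\<close> with the sum over the non-neighbours \<open>j\<close> of \<open>i\<close>, and
  \<open>u {} = 1 - \<Sum> X\<^sub>i\<^sub>i + \<Sum> X\<^sub>i\<^sub>j\<close> with the sums over the vertices and the non-edges. For the last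
  value, every non-edge weight is counted once in the total but in two diagonal entries
  (\<open>sum_nonedge_stars\<close>).

  In other words \<open>STAB2 H\<close> is a simplex. Vanishing at the edges says that \<open>X\<close> lies in its affine
  hull, and the inequalities say that the barycentric coordinates of \<open>X\<close> are nonnegative.
\<close>

lemma sum_nonedge_star:
  fixes w :: "'v::finite set \<Rightarrow> real"
  assumes "i \<in> verts H"
  shows "(\<Sum>j \<in> {j \<in> verts H. {i, j} \<in> nonedges H}. w {i, j}) = (\<Sum>e | e \<in> nonedges H \<and> i \<in> e. w e)"
proof (rule sum.reindex_bij_betw[where h = "\<lambda>j. {i, j}"])
  show "bij_betw (\<lambda>j. {i, j}) {j \<in> verts H. {i, j} \<in> nonedges H} {e \<in> nonedges H. i \<in> e}"
  proof (rule bij_betwI')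
    fix e assume "e \<in> {e \<in> nonedges H. i \<in> e}"
    then have "e \<in> nonedges H" and "i \<in> e" and "card e = 2"
      by (auto simp: nonedges_def)
    then obtain j where "e = {i, j}" and "e \<in> nonedges H"
      by (metis card_2_iff insert_commute insertE singletonD)
    then show "\<exists>j \<in> {j \<in> verts H. {i, j} \<in> nonedges H}. e = {i, j}"
      by (auto simp: nonedges_def)
  qed (auto simp: doubleton_eq_iff)
qed

text \<open>Double counting: a non-edge lies in the stars of its two ends and in no others.\<close>

lemma sum_nonedge_stars:
  fixes w :: "'v::finite set \<Rightarrow> real"
  shows "(\<Sum>i\<in>verts H. \<Sum>e | e \<in> nonedges H \<and> i \<in> e. w e) = 2 * (\<Sum>e\<in>nonedges H. w e)"
proof -
  have "(\<Sum>i\<in>verts H. \<Sum>e | e \<in> nonedges H \<and> i \<in> e. w e)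
      = (\<Sum>e\<in>nonedges H. \<Sum>i | i \<in> verts H \<and> i \<in> e. w e)"
    by (rule sum.swap_restrict) auto
  also have "\<dots> = (\<Sum>e\<in>nonedges H. 2 * w e)"
  proof (rule sum.cong)
    fix e assume "e \<in> nonedges H"
    then have "{i \<in> verts H. i \<in> e} = e" and "card e = 2"
      by (auto simp: nonedges_def)
    then show "(\<Sum>i | i \<in> verts H \<and> i \<in> e. w e) = 2 * w e" by simp
  qed simp
  finally show ?thesis by (simp add: sum_distrib_left)
qed

lemma stable_sets_eq_if_stability_number_2:
  fixes H :: "'v::finite ugraph"
  assumes "stability_number H = 2"
  shows "stable_sets H = {{}} \<union> (\<lambda>i. {i}) ` verts H \<union> nonedges H"
proof (intro equalityI subsetI)
  fix S assume S: "S \<in> stable_sets H"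
  have "card S \<le> Max (card ` stable_sets H)" using S by (intro Max_ge) auto
  then have "card S \<le> 2" using assms by (simp add: stability_number_def)
  then consider "card S = 0" | "card S = 1" | "card S = 2" by linarith
  then show "S \<in> {{}} \<union> (\<lambda>i. {i}) ` verts H \<union> nonedges H"
  proof cases
    case 2
    then show ?thesis using S by (auto simp: card_1_singleton_iff stable_sets_def)
  next
    case 3
    then obtain a b where "S = {a, b}" "a \<noteq> b" by (auto simp: card_2_iff)
    then show ?thesis using S 3 by (auto simp: stable_sets_def nonedges_def)
  qed simp
next
  fix S assume "S \<in> {{}} \<union> (\<lambda>i. {i}) ` verts H \<union> nonedges H"
  then show "S \<in> stable_sets H"
    by (auto simp: stable_sets_def nonedges_def card_2_iff insert_commute)
qed

lemma sum_stable_sets: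
  fixes u :: "'v::finite set \<Rightarrow> real"
  assumes "stability_number H = 2"
  shows "(\<Sum>S\<in>stable_sets H. u S) = u {} + (\<Sum>i\<in>verts H. u {i}) + (\<Sum>e\<in>nonedges H. u e)"
proof -
  have "(\<Sum>S\<in>stable_sets H. u S)
      = (\<Sum>S\<in>{{}} \<union> (\<lambda>i. {i}) ` verts H. u S) + (\<Sum>e\<in>nonedges H. u e)"
    unfolding stable_sets_eq_if_stability_number_2[OF assms]
    by (rule sum.union_disjoint) (auto simp: nonedges_def)
  also have "(\<Sum>S\<in>{{}} \<union> (\<lambda>i. {i}) ` verts H. u S) = u {} + (\<Sum>i\<in>verts H. u {i})"
    by (subst sum.union_disjoint) (auto simp: sum.reindex)
  finally show ?thesis .
qed

lemma sum_stable_sets_containing_vertex: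
  fixes u :: "'v::finite set \<Rightarrow> real"
  assumes "stability_number H = 2" and "i \<in> verts H"
  shows "(\<Sum>S | S \<in> stable_sets H \<and> i \<in> S. u S) = u {i} + (\<Sum>e | e \<in> nonedges H \<and> i \<in> e. u e)"
proof -
  have "{S \<in> stable_sets H. i \<in> S} = insert {i} {e \<in> nonedges H. i \<in> e}"
    using assms by (auto simp: stable_sets_eq_if_stability_number_2)
  moreover have "{i} \<notin> {e \<in> nonedges H. i \<in> e}" by (auto simp: nonedges_def)
  ultimately show ?thesis by simp
qed

lemma sum_stable_sets_containing_nonedge:
  fixes u :: "'v::finite set \<Rightarrow> real"
  assumes "stability_number H = 2" and "{i, j} \<in> nonedges H"
  shows "(\<Sum>S | S \<in> stable_sets H \<and> i \<in> S \<and> j \<in> S. u S) = u {i, j}"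
proof -
  have "i \<noteq> j" using assms(2) by (auto simp: nonedges_def)
  then have "{S \<in> stable_sets H. i \<in> S \<and> j \<in> S} = {{i, j}}"
    using assms by (auto simp: stable_sets_eq_if_stability_number_2 nonedges_def card_2_iff)
  then show ?thesis by simp
qed

text \<open>
  Distinct stable sets give distinct matrices, since the diagonal of \<open>s s\<^sup>T\<close> is \<open>s\<close>. The weights
  may therefore be indexed by the stable sets themselves.
\<close>

lemma mem_STAB2_iff_weights:
  fixes H :: "'v::finite ugraph"
  shows "Y \<in> STAB2 H \<longleftrightarrow>
    (\<exists>u. (\<forall>S\<in>stable_sets H. 0 \<le> u S) \<and> (\<Sum>S\<in>stable_sets H. u S) = 1 \<and>
      (\<forall>i j. Y $ i $ j = (\<Sum>S | S \<in> stable_sets H \<and> i \<in> S \<and> j \<in> S. u S)))"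
proof -
  define M :: "'v set \<Rightarrow> real ^ 'v ^ 'v" where "M S = outer (\<chi> v. indicator S v)" for S
  have M_nth: "M S $ i $ j = (if i \<in> S \<and> j \<in> S then 1 else 0)" for S i j
    by (simp add: M_def outer_def indicator_def)
  have "inj M"
  proof (rule injI)
    fix S T assume "M S = M T"
    then have "M S $ i $ i = M T $ i $ i" for i by simp
    then have "i \<in> S \<longleftrightarrow> i \<in> T" for i by (metis M_nth zero_neq_one)
    then show "S = T" by blast
  qed
  then have inj: "inj_on M (stable_sets H)" by (rule inj_on_subset) simp
  have hull: "STAB2 H = convex hull (M ` stable_sets H)"
    unfolding STAB2_def stable_matrices_def stable_vectors_def M_def by (simp add: image_image)
  have comb_nth: "(\<Sum>S\<in>stable_sets H. u S *\<^sub>R M S) $ i $ j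
      = (\<Sum>S | S \<in> stable_sets H \<and> i \<in> S \<and> j \<in> S. u S)" for u :: "'v set \<Rightarrow> real" and i j
  proof -
    have "(\<Sum>S\<in>stable_sets H. u S *\<^sub>R M S) $ i $ j
        = (\<Sum>S\<in>stable_sets H. if i \<in> S \<and> j \<in> S then u S else 0)"
      by (simp add: M_nth if_distrib cong: if_cong)
    then show ?thesis by (simp add: sum.inter_filter)
  qed
  show ?thesis
  proof
    assume "Y \<in> STAB2 H"
    then obtain v where v: "\<forall>A\<in>M ` stable_sets H. 0 \<le> v A" "sum v (M ` stable_sets H) = 1"
        "(\<Sum>A\<in>M ` stable_sets H. v A *\<^sub>R A) = Y"
      unfolding hull by (subst (asm) convex_hull_finite) auto
    then have "(\<Sum>S\<in>stable_sets H. (v \<circ> M) S) = 1" "(\<Sum>S\<in>stable_sets H. (v \<circ> M) S *\<^sub>R M S) = Y"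
      using inj by (simp_all add: sum.reindex)
    then show "\<exists>u. (\<forall>S\<in>stable_sets H. 0 \<le> u S) \<and> (\<Sum>S\<in>stable_sets H. u S) = 1 \<and>
        (\<forall>i j. Y $ i $ j = (\<Sum>S | S \<in> stable_sets H \<and> i \<in> S \<and> j \<in> S. u S))"
      using v(1) comb_nth[of "v \<circ> M"] by (intro exI[of _ "v \<circ> M"]) auto
  next
    assume "\<exists>u. (\<forall>S\<in>stable_sets H. 0 \<le> u S) \<and> (\<Sum>S\<in>stable_sets H. u S) = 1 \<and>
        (\<forall>i j. Y $ i $ j = (\<Sum>S | S \<in> stable_sets H \<and> i \<in> S \<and> j \<in> S. u S))"
    then obtain u where u: "\<forall>S\<in>stable_sets H. 0 \<le> u S" "(\<Sum>S\<in>stable_sets H. u S) = 1"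
        "\<forall>i j. Y $ i $ j = (\<Sum>S | S \<in> stable_sets H \<and> i \<in> S \<and> j \<in> S. u S)" by blast
    have "(\<Sum>S\<in>stable_sets H. u S *\<^sub>R M S) \<in> STAB2 H"
      unfolding hull using u(1,2) by (intro convex_sum) (auto intro: hull_inc)
    moreover have "Y = (\<Sum>S\<in>stable_sets H. u S *\<^sub>R M S)"
      unfolding vec_eq_iff comb_nth using u(3) by simp
    ultimately show "Y \<in> STAB2 H" by simp
  qed
qed

theorem theorem4:
  fixes G :: "'v::finite ugraph" and I :: "'v set" and X :: "real ^ 'v ^ 'v"
  assumes "simple_graph G"
    and "I \<subseteq> verts G"
    and "stability_number (induced G I) = 2"
    and "\<forall>i\<in>I. \<forall>j\<in>I. X $ i $ j = X $ j $ i"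
  shows "submatrix_on I X \<in> STAB2 (induced G I) \<longleftrightarrow>
      (\<forall>i\<in>I. X $ i $ i \<ge> 0) \<and>
      (\<forall>i j. {i, j} \<in> edges (induced G I) \<longrightarrow> X $ i $ j = 0) \<and>
      (\<forall>i j. {i, j} \<in> nonedges (induced G I) \<longrightarrow> X $ i $ j \<ge> 0) \<and>
      (\<forall>i\<in>I. (\<Sum>j \<in> {j \<in> I. {i, j} \<in> nonedges (induced G I)}. X $ i $ j) \<le> X $ i $ i) \<and>
      (\<Sum>i\<in>I. X $ i $ i) \<le> 1 + (\<Sum>e \<in> nonedges (induced G I). pair_entry X e)"
proof -
  define H where "H = induced G I"
  have verts: "verts H = I" and alpha: "stability_number H = 2"
    using assms(3) by (simp_all add: H_def induced_def)
  have edge: "a \<in> I \<and> b \<in> I \<and> a \<noteq> b" if "{a, b} \<in> edges H" for a b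
    using that assms(1) by (auto simp: H_def induced_def simple_graph_def)
  have nonedge: "a \<in> I \<and> b \<in> I \<and> a \<noteq> b" if "{a, b} \<in> nonedges H" for a b
    using that verts by (auto simp: nonedges_def)
  have pair: "pair_entry X {a, b} = X $ a $ b" if "{a, b} \<in> nonedges H" for a b
    using nonedge[OF that] assms(4) by (intro pair_entry_eq) auto
  have star: "(\<Sum>j \<in> {j \<in> I. {i, j} \<in> nonedges H}. X $ i $ j)
      = (\<Sum>e | e \<in> nonedges H \<and> i \<in> e. pair_entry X e)" if "i \<in> I" for i
    using sum_nonedge_star[of i H "pair_entry X"] that verts by (simp add: pair)
  let ?Y = "submatrix_on I X"
  let ?N = "nonedges H"
  show ?thesis
    unfolding H_def[symmetric]
  proof (intro iffI conjI; (elim conjE)?)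
    assume "?Y \<in> STAB2 H"
    then obtain u where u: "\<forall>S\<in>stable_sets H. 0 \<le> u S" "(\<Sum>S\<in>stable_sets H. u S) = 1"
        "\<forall>i j. ?Y $ i $ j = (\<Sum>S | S \<in> stable_sets H \<and> i \<in> S \<and> j \<in> S. u S)"
      unfolding mem_STAB2_iff_weights by blast
    have entry: "X $ i $ j = (\<Sum>S | S \<in> stable_sets H \<and> i \<in> S \<and> j \<in> S. u S)"
      if "i \<in> I" "j \<in> I" for i j
      using u(3)[rule_format, of i j] that by (simp add: submatrix_on_def)
    have diag: "X $ i $ i = u {i} + (\<Sum>e | e \<in> ?N \<and> i \<in> e. u e)" if "i \<in> I" for i
      using entry[OF that that] sum_stable_sets_containing_vertex[OF alpha, of i u] that verts
      by simp
    have offdiag: "X $ i $ j = u {i, j}" if "{i, j} \<in> ?N" for i j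
      using entry[of i j] sum_stable_sets_containing_nonedge[OF alpha that, of u] nonedge[OF that]
      by simp
    have pair_u: "pair_entry X e = u e" if "e \<in> ?N" for e
    proof -
      obtain a b where "e = {a, b}" using \<open>e \<in> ?N\<close> by (auto simp: nonedges_def card_2_iff)
      then show ?thesis using that pair offdiag by simp
    qed
    have nonneg: "0 \<le> u {}" "\<And>i. i \<in> I \<Longrightarrow> 0 \<le> u {i}" "\<And>e. e \<in> ?N \<Longrightarrow> 0 \<le> u e"
      using u(1) verts by (auto simp: stable_sets_eq_if_stability_number_2[OF alpha])
    show "\<forall>i\<in>I. 0 \<le> X $ i $ i"
      using diag nonneg by (auto intro!: add_nonneg_nonneg sum_nonneg)
    show "\<forall>i j. {i, j} \<in> edges H \<longrightarrow> X $ i $ j = 0"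
    proof (intro allI impI)
      fix i j assume ij: "{i, j} \<in> edges H"
      then have none: "{S \<in> stable_sets H. i \<in> S \<and> j \<in> S} = {}"
        using edge[OF ij] by (auto simp: stable_sets_def)
      show "X $ i $ j = 0" using entry[of i j] edge[OF ij] unfolding none by simp
    qed
    show "\<forall>i j. {i, j} \<in> ?N \<longrightarrow> 0 \<le> X $ i $ j"
      using offdiag nonneg by simp
    show "\<forall>i\<in>I. (\<Sum>j \<in> {j \<in> I. {i, j} \<in> ?N}. X $ i $ j) \<le> X $ i $ i"
      using star diag nonneg(2) pair_u by simp
    have "(\<Sum>i\<in>I. X $ i $ i) = (\<Sum>i\<in>I. u {i}) + 2 * (\<Sum>e\<in>?N. u e)"
      using diag sum_nonedge_stars[of u H] verts by (simp add: sum.distrib)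
    then show "(\<Sum>i\<in>I. X $ i $ i) \<le> 1 + (\<Sum>e\<in>?N. pair_entry X e)"
      using u(2) sum_stable_sets[OF alpha, of u] nonneg(1) verts pair_u by simp
  next
    assume edge0: "\<forall>i j. {i, j} \<in> edges H \<longrightarrow> X $ i $ j = 0"
      and nonedge_nonneg: "\<forall>i j. {i, j} \<in> ?N \<longrightarrow> 0 \<le> X $ i $ j"
      and star_le: "\<forall>i\<in>I. (\<Sum>j \<in> {j \<in> I. {i, j} \<in> ?N}. X $ i $ j) \<le> X $ i $ i"
      and total_le: "(\<Sum>i\<in>I. X $ i $ i) \<le> 1 + (\<Sum>e\<in>?N. pair_entry X e)"
    \<comment> \<open>The inverse of the triangular system, solved from the non-edges down to the empty set.\<close>
    define w where "w = pair_entry X"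
    \<comment> \<open>The second branch is meant for singletons, whose element \<open>the_elem\<close> returns.\<close>
    define u where "u S =
      (if S = {} then 1 - (\<Sum>i\<in>I. X $ i $ i) + (\<Sum>e\<in>?N. w e)
       else if card S = 1
       then X $ the_elem S $ the_elem S - (\<Sum>e | e \<in> ?N \<and> the_elem S \<in> e. w e)
       else w S)" for S
    have u_empty: "u {} = 1 - (\<Sum>i\<in>I. X $ i $ i) + (\<Sum>e\<in>?N. w e)"
      and u_single: "u {i} = X $ i $ i - (\<Sum>e | e \<in> ?N \<and> i \<in> e. w e)" for i
      by (simp_all add: u_def)
    have u_pair: "u e = w e" if "e \<in> ?N" for e
      using that by (auto simp: u_def nonedges_def)
    have "0 \<le> u S" if S: "S \<in> stable_sets H" for S
    proof -
      consider "S = {}" | i where "S = {i}" "i \<in> I" | "S \<in> ?N"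
        using S verts by (auto simp: stable_sets_eq_if_stability_number_2[OF alpha])
      then show ?thesis
      proof cases
        case 1
        then show ?thesis using total_le u_empty by (simp add: w_def)
      next
        case 2
        then show ?thesis using star_le star u_single by (simp add: w_def)
      next
        case 3
        then obtain a b where "S = {a, b}" by (auto simp: nonedges_def card_2_iff)
        then show ?thesis using 3 u_pair pair nonedge_nonneg by (simp add: w_def)
      qed
    qed
    moreover have "(\<Sum>S\<in>stable_sets H. u S) = 1"
    proof -
      have "(\<Sum>i\<in>I. u {i}) = (\<Sum>i\<in>I. X $ i $ i) - 2 * (\<Sum>e\<in>?N. w e)"
        using sum_nonedge_stars[of w H] verts by (simp add: u_single sum_subtractf)
      then show ?thesis
        using sum_stable_sets[OF alpha, of u] verts by (simp add: u_empty u_pair)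
    qed
    moreover have "?Y $ i $ j = (\<Sum>S | S \<in> stable_sets H \<and> i \<in> S \<and> j \<in> S. u S)" for i j
    proof -
      consider "i \<notin> I \<or> j \<notin> I" | "i \<in> I" "j = i" | "{i, j} \<in> edges H" | "{i, j} \<in> ?N"
        using verts by (auto simp: nonedges_def card_2_iff)
      then show ?thesis
      proof cases
        case 1
        then have none: "{S \<in> stable_sets H. i \<in> S \<and> j \<in> S} = {}"
          using verts by (auto simp: stable_sets_def)
        show ?thesis unfolding none using 1 by (auto simp: submatrix_on_def)
      next
        case 2
        then show ?thesis
          using sum_stable_sets_containing_vertex[OF alpha, of i u] verts
          by (simp add: submatrix_on_def u_single u_pair)
      next
        case 3
        then have none: "{S \<in> stable_sets H. i \<in> S \<and> j \<in> S} = {}"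
          using edge[OF 3] by (auto simp: stable_sets_def)
        show ?thesis unfolding none using 3 edge0 by (simp add: submatrix_on_def)
      next
        case 4
        then show ?thesis
          using sum_stable_sets_containing_nonedge[OF alpha 4, of u] nonedge[OF 4]
          by (simp add: submatrix_on_def u_pair w_def pair)
      qed
    qed
    ultimately show "?Y \<in> STAB2 H"
      unfolding mem_STAB2_iff_weights by blast
  qed
qed

end
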